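(* For all integers $m>j\ge 0$ and all integers $n\ge 1$, $$\sum_{i=0}^{n-1}\mathcal{T}_{-mi-j}=\frac{\mathcal{T}_{-mn+m-j}+\mathcal{T}_{-mn-m-j}+(1-K_{-m})\mathcal{T}_{-mn-j}}{K_{-m}-K_{m}}-\frac{\mathcal{T}_{-m-j}+\mathcal{T}_{-j+m}+(1-K_{-m})\mathcal{T}_{-j}}{K_{-m}-K_{m}}$$ and $$\sum_{i=0}^{n-1}\mathcal{K}_{-mi-j}=\frac{\mathcal{K}_{-mn+m-j}+\mathcal{K}_{-mn-m-j}+(1-K_{-m})\mathcal{K}_{-mn-j}}{K_{-m}-K_{m}}-\frac{\mathcal{K}_{-m-j}+\mathcal{K}_{-j+m}+(1-K_{-m})\mathcal{K}_{-j}}{K_{-m}-K_{m}}.$$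
   Context: The Tribonacci-Lucas numbers $(K_n)_{n\in\mathbb{Z}}$ are defined by $K_0=3$, $K_1=1$, $K_2=3$ and $K_n=K_{n-1}+K_{n-2}+K_{n-3}$ for all integers $n$ (so that the sequence is extended to negative indices by running the recurrence backwards). The Tribonacci matrix sequence $(\mathcal{T}_n)_{n\in\mathbb{Z}}$ and Tribonacci-Lucas matrix sequence $(\mathcal{K}_n)_{n\in\mathbb{Z}}$ are the sequences of $3\times 3$ matrices satisfying $\mathcal{T}_n=\mathcal{T}_{n-1}+\mathcal{T}_{n-2}+\mathcal{T}_{n-3}$ and $\mathcal{K}_n=\mathcal{K}_{n-1}+\mathcal{K}_{n-2}+\mathcal{K}_{n-3}$ for all integers $n$ (again extended backwards to negative indices), with $$\mathcal{T}_{0}=I_3,\quad \mathcal{T}_{1}=\begin{pmatrix}1&1&1\\1&0&0\\0&1&0\end{pmatrix},\quad \mathcal{T}_{2}=\begin{pmatrix}2&2&1\\1&1&1\\1&0&0\end{pmatrix},$$ $$\mathcal{K}_{0}=\begin{pmatrix}1&2&3\\3&-2&-1\\-1&4&-1\end{pmatrix},\quad \mathcal{K}_{1}=\begin{pmatrix}3&4&1\\1&2&3\\3&-2&-1\end{pmatrix},\quad \mathcal{K}_{2}=\begin{pmatrix}7&4&3\\3&4&1\\1&2&3\end{pmatrix}.$$ *)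

theory Defs
  imports "HOL-Analysis.Analysis"
begin

text \<open>
  The two-sided sequence with initial values \<open>a\<close>, \<open>b\<close>, \<open>c\<close> at 0, 1, 2. For negative indices
  the recurrence is solved for its lowest term. The lemmas \<open>tribonacci_seq_rec\<close> and
  \<open>tribonacci_seq_unique\<close> state that this is the unique sequence with these initial values
  that satisfies the Tribonacci recurrence at all integers.
\<close>

function tribonacci_seq :: "'a::ab_group_add \<Rightarrow> 'a \<Rightarrow> 'a \<Rightarrow> int \<Rightarrow> 'a" where
  "tribonacci_seq a b c n =
    (if n = 0 then a else if n = 1 then b else if n = 2 then c
     else if n > 2 then
       tribonacci_seq a b c (n - 1) + tribonacci_seq a b c (n - 2) + tribonacci_seq a b c (n - 3)
     else
       tribonacci_seq a b c (n + 3) - tribonacci_seq a b c (n + 2) - tribonacci_seq a b c (n + 1))"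
  by auto
termination
  by (relation "Wellfounded.measure (\<lambda>(a, b, c, n). nat \<bar>n - 1\<bar>)") auto

declare tribonacci_seq.simps [simp del]

lemma tribonacci_seq_init:
  "tribonacci_seq a b c 0 = a" "tribonacci_seq a b c 1 = b" "tribonacci_seq a b c 2 = c"
  by (simp_all add: tribonacci_seq.simps)

lemma tribonacci_seq_rec:
  "tribonacci_seq a b c n =
     tribonacci_seq a b c (n - 1) + tribonacci_seq a b c (n - 2) + tribonacci_seq a b c (n - 3)"
proof (cases "n > 2")
  case True
  then show ?thesis by (subst tribonacci_seq.simps) simp
next
  case False
  then have "tribonacci_seq a b c (n - 3) =
      tribonacci_seq a b c n - tribonacci_seq a b c (n - 1) - tribonacci_seq a b c (n - 2)"
    by (subst tribonacci_seq.simps) simp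
  then show ?thesis by simp
qed

lemma tribonacci_seq_unique:
  assumes "f 0 = a" "f 1 = b" "f 2 = c"
    and rec: "\<And>n. f n = f (n - 1) + f (n - 2) + f (n - 3)"
  shows "f n = tribonacci_seq a b c n"
  using assms(1-3)
proof (induction a b c n rule: tribonacci_seq.induct)
  case (1 a b c n)
  consider "n = 0 \<or> n = 1 \<or> n = 2" | "n > 2" | "n < 0" by linarith
  then show ?case
  proof cases
    case 1
    then show ?thesis using "1.prems" by (auto simp: tribonacci_seq_init)
  next
    case 2
    then show ?thesis
      using "1.IH"(1-3) "1.prems" rec[of n] tribonacci_seq_rec[of a b c n] by simp
  next
    case 3
    then show ?thesis
      using "1.IH"(4-6) "1.prems" rec[of "n + 3"] tribonacci_seq_rec[of a b c "n + 3"]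
      by (simp add: algebra_simps)
  qed
qed

definition trib_lucas :: "int \<Rightarrow> int" where
  "trib_lucas = tribonacci_seq 3 1 3"

definition trib_matrix :: "int \<Rightarrow> real^3^3" where
  "trib_matrix = tribonacci_seq
     (mat 1)
     (vector [vector [1, 1, 1],
              vector [1, 0, 0],
              vector [0, 1, 0]])
     (vector [vector [2, 2, 1],
              vector [1, 1, 1],
              vector [1, 0, 0]])"

definition trib_lucas_matrix :: "int \<Rightarrow> real^3^3" where
  "trib_lucas_matrix = tribonacci_seq
     (vector [vector [1, 2, 3],
              vector [3, - 2, - 1],
              vector [- 1, 4, - 1]])
     (vector [vector [3, 4, 1],
              vector [1, 2, 3],
              vector [3, - 2, - 1]])
     (vector [vector [7, 4, 3],
              vector [3, 4, 1],
              vector [1, 2, 3]])"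

end

theory Submission
  imports Defs
begin

text \<open>
  Let \<open>\<alpha>\<^sub>1, \<alpha>\<^sub>2, \<alpha>\<^sub>3\<close> be the roots of \<open>x^3 = x^2 + x + 1\<close>, so that \<open>\<alpha>\<^sub>1 \<alpha>\<^sub>2 \<alpha>\<^sub>3 = 1\<close>, and let
  \<open>K\<close> be the Tribonacci-Lucas sequence, which is the power sum
  \<open>K\<^sub>q = \<alpha>\<^sub>1^q + \<alpha>\<^sub>2^q + \<alpha>\<^sub>3^q\<close>. The powers \<open>\<alpha>\<^sub>i^m\<close> are the roots of
  \<open>x^3 - K\<^sub>m x^2 + K\<^sub>-\<^sub>m x - 1\<close>: their second elementary symmetric function is the sum of
  their inverses, because their product is 1. A sequence \<open>V\<close> with the Tribonacci recurrence is a
  combination of the \<open>\<alpha>\<^sub>i^k\<close>, and so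
  \<open>V(k + m) - K\<^sub>m V(k) + K\<^sub>-\<^sub>m V(k - m) - V(k - 2m) = 0\<close> (lemma \<open>trib_lucas_step\<close>).

  By this relation, \<open>V(k + m) + V(k - m) + (1 - K\<^sub>-\<^sub>m) V(k)\<close> changes by \<open>(K\<^sub>-\<^sub>m - K\<^sub>m) V(k)\<close> when
  \<open>k\<close> is replaced by \<open>k - m\<close>, and the sum over the progression telescopes
  (lemma \<open>scaled_sum_telescopes\<close>). This argument holds in every real vector space, in particular
  for both matrix sequences.

  The division by \<open>K\<^sub>-\<^sub>m - K\<^sub>m\<close> is meaningful for \<open>m > 0\<close> since the sequence grows faster to
  the right than in absolute value to the left (lemma \<open>trib_lucas_neg_neq\<close>).
\<close>

section \<open>Sequences with the Tribonacci recurrence\<close>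

definition tribonacci_rec :: "(int \<Rightarrow> 'a::ab_group_add) \<Rightarrow> bool" where
  "tribonacci_rec V \<longleftrightarrow> (\<forall>n. V n = V (n - 1) + V (n - 2) + V (n - 3))"

lemma tribonacci_recD: "tribonacci_rec V \<Longrightarrow> V n = V (n - 1) + V (n - 2) + V (n - 3)"
  unfolding tribonacci_rec_def by blast

lemma tribonacci_rec_tribonacci_seq: "tribonacci_rec (tribonacci_seq a b c)"
  unfolding tribonacci_rec_def using tribonacci_seq_rec by blast

lemma tribonacci_rec_eqI:
  assumes "tribonacci_rec V" "tribonacci_rec W" "V 0 = W 0" "V 1 = W 1" "V 2 = W 2"
  shows "V n = W n"
  using assms tribonacci_seq_unique[of V "W 0" "W 1" "W 2" n]
    tribonacci_seq_unique[of W "W 0" "W 1" "W 2" n]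
  by (metis tribonacci_recD)

section \<open>The Tribonacci-Lucas numbers\<close>

lemma trib_lucas_rec:
  "trib_lucas n = trib_lucas (n - 1) + trib_lucas (n - 2) + trib_lucas (n - 3)"
  unfolding trib_lucas_def by (rule tribonacci_seq_rec)

lemma trib_lucas_values:
  "trib_lucas 0 = 3" "trib_lucas 1 = 1" "trib_lucas 2 = 3" "trib_lucas 3 = 7" "trib_lucas 4 = 11"
  "trib_lucas (-1) = -1" "trib_lucas (-2) = -1" "trib_lucas (-3) = 5" "trib_lucas (-4) = -5"
proof -
  show i: "trib_lucas 0 = 3" "trib_lucas 1 = 1" "trib_lucas 2 = 3"
    by (simp_all add: trib_lucas_def tribonacci_seq_init)
  show p3: "trib_lucas 3 = 7" using trib_lucas_rec[of 3] i by simp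
  show "trib_lucas 4 = 11" using trib_lucas_rec[of 4] i p3 by simp
  show n1: "trib_lucas (-1) = -1" using trib_lucas_rec[of 2] i by simp
  show n2: "trib_lucas (-2) = -1" using trib_lucas_rec[of 1] i n1 by simp
  show n3: "trib_lucas (-3) = 5" using trib_lucas_rec[of 0] i n1 n2 by simp
  show "trib_lucas (-4) = -5" using trib_lucas_rec[of "-1"] n1 n2 n3 by simp
qed

lemma trib_lucas_pos: "0 \<le> n \<Longrightarrow> trib_lucas n > 0"
proof (induction "nat n" arbitrary: n rule: less_induct)
  case less
  show ?case
  proof (cases "n \<le> 2")
    case True
    then have "n = 0 \<or> n = 1 \<or> n = 2" using less.prems by linarith
    then show ?thesis using trib_lucas_values by auto
  next
    case False
    then show ?thesis
      using less.hyps[of "n - 1"] less.hyps[of "n - 2"] less.hyps[of "n - 3"]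
        trib_lucas_rec[of n] by simp
  qed
qed

text \<open>
  Using the recurrence twice gives \<open>K(-n) = 2 K(3 - n) - K(4 - n)\<close>, in which the indices are smaller by
  3 and 4 in absolute value. Inductively this bounds \<open>\<bar>K(-n)\<bar>\<close> by \<open>2 K(n - 3) + K(n - 4)\<close>, while
  \<open>K(n) = 2 K(n - 2) + 2 K(n - 3) + K(n - 4)\<close>. Strictness fails at \<open>n = 1\<close>, where \<open>K(-1) = -K(1)\<close>,
  so the inductive statement has \<open>\<le>\<close>.
\<close>

lemma abs_trib_lucas_neg_le:
  assumes "1 \<le> n"
  shows "\<bar>trib_lucas (- n)\<bar> \<le> trib_lucas n \<and> trib_lucas (- n) \<noteq> trib_lucas n"
  using assms
proof (induction "nat n" arbitrary: n rule: less_induct)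
  case less
  show ?case
  proof (cases "n \<le> 4")
    case True
    then have "n = 1 \<or> n = 2 \<or> n = 3 \<or> n = 4" using less.prems by linarith
    then show ?thesis using trib_lucas_values by auto
  next
    case False
    have "\<bar>trib_lucas (- (n - 3))\<bar> \<le> trib_lucas (n - 3)"
      and "\<bar>trib_lucas (- (n - 4))\<bar> \<le> trib_lucas (n - 4)"
      using less.hyps[of "n - 3"] less.hyps[of "n - 4"] False by auto
    moreover have "trib_lucas (- n) = 2 * trib_lucas (- (n - 3)) - trib_lucas (- (n - 4))"
      using trib_lucas_rec[of "- n + 3"] trib_lucas_rec[of "- n + 4"] by (simp add: algebra_simps)
    moreover have "trib_lucas n = 2 * trib_lucas (n - 2) + 2 * trib_lucas (n - 3) + trib_lucas (n - 4)"
      using trib_lucas_rec[of n] trib_lucas_rec[of "n - 1"] by simp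
    moreover have "trib_lucas (n - 2) > 0"
      using trib_lucas_pos False by simp
    ultimately show ?thesis using False trib_lucas_pos[of "n - 3"] by linarith
  qed
qed

lemma trib_lucas_neg_neq: "1 \<le> n \<Longrightarrow> trib_lucas (- n) \<noteq> trib_lucas n"
  using abs_trib_lucas_neg_le by blast

section \<open>Recurrence along an arithmetic progression\<close>

text \<open>
  If \<open>V(p)\<close> is the sum of \<open>\<gamma>\<^sub>i \<alpha>\<^sub>i^p\<close> over the roots \<open>\<alpha>\<^sub>i\<close> of \<open>x^3 = x^2 + x + 1\<close>, then
  \<open>mixed_part V p q\<close> is the sum of \<open>\<gamma>\<^sub>i \<alpha>\<^sub>i^p \<alpha>\<^sub>j^q\<close> over \<open>i \<noteq> j\<close>: the product of the two
  power sums without its diagonal.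
\<close>

definition mixed_part :: "(int \<Rightarrow> 'a::real_vector) \<Rightarrow> int \<Rightarrow> int \<Rightarrow> 'a" where
  "mixed_part V p q = real_of_int (trib_lucas q) *\<^sub>R V p - V (p + q)"

lemma tribonacci_rec_mixed_part:
  fixes V :: "int \<Rightarrow> 'a::real_vector"
  assumes "tribonacci_rec V"
  shows "tribonacci_rec (mixed_part V p)"
  unfolding tribonacci_rec_def
proof
  fix n
  show "mixed_part V p n = mixed_part V p (n - 1) + mixed_part V p (n - 2) + mixed_part V p (n - 3)"
    unfolding mixed_part_def
    using tribonacci_recD[OF assms, of "p + n"]
    by (subst trib_lucas_rec) (simp add: algebra_simps)
qed

lemma small_numeral_scaleR:
  fixes x :: "'a::real_vector"
  shows "3 *\<^sub>R x = x + x + x" "5 *\<^sub>R x = x + x + x + x + x"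
  using scaleR_left_distrib[of 1 2 x] scaleR_left_distrib[of 2 3 x]
  by (simp_all add: scaleR_2 algebra_simps)

text \<open>
  Moving both arguments down by 1 multiplies the \<open>(i, j)\<close> summand of \<open>mixed_part V p q\<close> by
  \<open>(\<alpha>\<^sub>i \<alpha>\<^sub>j)^(-1)\<close>, which is the third root and so again satisfies the cubic equation. Without the
  roots: both sides satisfy the Tribonacci recurrence in \<open>q\<close>, and for \<open>q = 0, 1, 2\<close> the claim is
  a linear consequence of the recurrence of \<open>V\<close> around \<open>p\<close>.
\<close>

lemma mixed_part_diagonal:
  fixes V :: "int \<Rightarrow> 'a::real_vector"
  assumes V: "tribonacci_rec V"
  shows "mixed_part V (p - 3) (q - 3) =
    mixed_part V (p - 2) (q - 2) + mixed_part V (p - 1) (q - 1) + mixed_part V p q"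
proof -
  have F: "mixed_part V r s = mixed_part V r (s - 1) + mixed_part V r (s - 2) + mixed_part V r (s - 3)"
    for r s
    using tribonacci_recD[OF tribonacci_rec_mixed_part[OF V]] .
  let ?L = "\<lambda>q. mixed_part V (p - 3) (q - 3)"
  let ?R = "\<lambda>q. mixed_part V (p - 2) (q - 2) + mixed_part V (p - 1) (q - 1) + mixed_part V p q"
  have "tribonacci_rec ?L"
    unfolding tribonacci_rec_def using F[of "p - 3" "q - 3" for q] by (simp add: algebra_simps)
  moreover have "tribonacci_rec ?R"
    unfolding tribonacci_rec_def
  proof
    fix q
    show "?R q = ?R (q - 1) + ?R (q - 2) + ?R (q - 3)"
      using F[of "p - 2" "q - 2"] F[of "p - 1" "q - 1"] F[of p q] by (simp add: algebra_simps)
  qed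
  moreover have "?L 0 = ?R 0" "?L 1 = ?R 1" "?L 2 = ?R 2"
  proof -
    \<comment> \<open>All values of \<open>V\<close> that occur, expressed through those at \<open>p - 2\<close>, \<open>p - 1\<close>, \<open>p\<close>.\<close>
    have a: "V (p - 3) = V p - V (p - 1) - V (p - 2)"
      using tribonacci_recD[OF V, of p] by (simp add: algebra_simps)
    have b: "V (p - 4) = V (p - 1) - V (p - 2) - V (p - 3)"
      using tribonacci_recD[OF V, of "p - 1"] by (simp add: algebra_simps)
    have c: "V (p - 5) = V (p - 2) - V (p - 3) - V (p - 4)"
      using tribonacci_recD[OF V, of "p - 2"] by (simp add: algebra_simps)
    have d: "V (p - 6) = V (p - 3) - V (p - 4) - V (p - 5)"
      using tribonacci_recD[OF V, of "p - 3"] by (simp add: algebra_simps)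
    have e: "V (p + 1) = V p + V (p - 1) + V (p - 2)"
      using tribonacci_recD[OF V, of "p + 1"] by simp
    have f: "V (p + 2) = V (p + 1) + V p + V (p - 1)"
      using tribonacci_recD[OF V, of "p + 2"] by (simp add: algebra_simps)
    show "?L 0 = ?R 0" "?L 1 = ?R 1" "?L 2 = ?R 2"
      unfolding mixed_part_def
      by (simp_all add: trib_lucas_values small_numeral_scaleR a b c d e f)
  qed
  ultimately show ?thesis by (rule tribonacci_rec_eqI)
qed

text \<open>
  This is the vanishing of \<open>x^3 - K\<^sub>m x^2 + K\<^sub>-\<^sub>m x - 1\<close> at \<open>x = \<alpha>\<^sub>i^m\<close>. In terms of mixed parts it
  says \<open>mixed_part V k m = mixed_part V (k - m) (- m)\<close>. With \<open>{i, j, l} = {1, 2, 3}\<close> this follows from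
  \<open>\<alpha>\<^sub>i^k \<alpha>\<^sub>j^m = \<alpha>\<^sub>i^(k - m) \<alpha>\<^sub>l^(-m)\<close>, as the \<open>(i, j)\<close> summand on the left is the \<open>(i, l)\<close> summand on
  the right. Both sides satisfy the Tribonacci recurrence in \<open>m\<close>, the right one by
  \<open>mixed_part_diagonal\<close>, so only \<open>m = 0, 1, 2\<close> have to be compared.
\<close>

lemma trib_lucas_step:
  fixes V :: "int \<Rightarrow> 'a::real_vector"
  assumes V: "tribonacci_rec V"
  shows "real_of_int (trib_lucas m) *\<^sub>R V k - V (k + m) =
    real_of_int (trib_lucas (- m)) *\<^sub>R V (k - m) - V (k - 2 * m)"
proof -
  have "mixed_part V k m = mixed_part V (k - m) (- m)"
  proof (rule tribonacci_rec_eqI[where V = "mixed_part V k" and W = "\<lambda>m. mixed_part V (k - m) (- m)"])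
    show "tribonacci_rec (mixed_part V k)" by (rule tribonacci_rec_mixed_part[OF V])
    show "tribonacci_rec (\<lambda>m. mixed_part V (k - m) (- m))"
      unfolding tribonacci_rec_def
    proof
      fix n
      show "mixed_part V (k - n) (- n) = mixed_part V (k - (n - 1)) (- (n - 1))
        + mixed_part V (k - (n - 2)) (- (n - 2)) + mixed_part V (k - (n - 3)) (- (n - 3))"
        using mixed_part_diagonal[OF V, of "k - n + 3" "- n + 3"] by (simp add: algebra_simps)
    qed
    have "V (k + 1) = V k + V (k - 1) + V (k - 2)"
      using tribonacci_recD[OF V, of "k + 1"] by simp
    moreover have "V (k + 2) = V (k + 1) + V k + V (k - 1)"
      using tribonacci_recD[OF V, of "k + 2"] by (simp add: algebra_simps)
    moreover have "V (k - 4) = V (k - 1) - V (k - 2) - V (k - 3)" "V (k - 3) = V k - V (k - 1) - V (k - 2)"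
      using tribonacci_recD[OF V, of "k - 1"] tribonacci_recD[OF V, of k] by simp_all
    ultimately show "mixed_part V k 0 = mixed_part V (k - 0) (- 0)"
      "mixed_part V k 1 = mixed_part V (k - 1) (- 1)" "mixed_part V k 2 = mixed_part V (k - 2) (- 2)"
      unfolding mixed_part_def by (simp_all add: trib_lucas_values small_numeral_scaleR)
  qed
  then show ?thesis unfolding mixed_part_def by (simp add: algebra_simps)
qed

section \<open>The sum\<close>

lemma scaled_sum_telescopes:
  fixes V :: "int \<Rightarrow> 'a::real_vector"
  defines "N \<equiv> \<lambda>m k. V (k + m) + V (k - m) + real_of_int (1 - trib_lucas (- m)) *\<^sub>R V k"
  assumes V: "tribonacci_rec V" and "0 \<le> n"
  shows "real_of_int (trib_lucas (- m) - trib_lucas m) *\<^sub>R (\<Sum>i = 0..n - 1. V (- m * i - j)) =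
    N m (- m * n - j) - N m (- j)"
  using \<open>0 \<le> n\<close>
proof (induction n rule: int_ge_induct)
  case base
  show ?case by simp
next
  case (step n)
  let ?k = "- m * n - j"
  have "{0..n + 1 - 1} = insert n {0..n - 1}" using step.hyps by auto
  then have sum: "(\<Sum>i = 0..n + 1 - 1. V (- m * i - j)) = V ?k + (\<Sum>i = 0..n - 1. V (- m * i - j))"
    by simp
  have "N m (k - m) - N m k = real_of_int (trib_lucas (- m) - trib_lucas m) *\<^sub>R V k" for k
    using trib_lucas_step[OF V, of m k] unfolding N_def by (simp add: algebra_simps)
  moreover have "- m * (n + 1) - j = ?k - m" by (simp add: algebra_simps)
  ultimately show ?case
    using step.IH unfolding sum scaleR_add_right by (metis add_diff_eq diff_add_cancel)
qed

lemma tribonacci_progression_sum: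
  fixes V :: "int \<Rightarrow> 'a::real_vector"
  assumes V: "tribonacci_rec V" and "1 \<le> m" and "0 \<le> n"
  shows "(\<Sum>i = 0..n - 1. V (- m * i - j)) =
      (V (- m * n + m - j) + V (- m * n - m - j)
        + real_of_int (1 - trib_lucas (- m)) *\<^sub>R V (- m * n - j))
        /\<^sub>R real_of_int (trib_lucas (- m) - trib_lucas m)
      - (V (- m - j) + V (- j + m) + real_of_int (1 - trib_lucas (- m)) *\<^sub>R V (- j))
        /\<^sub>R real_of_int (trib_lucas (- m) - trib_lucas m)"
proof -
  let ?d = "real_of_int (trib_lucas (- m) - trib_lucas m)"
  have d: "?d \<noteq> 0" using trib_lucas_neg_neq[OF \<open>1 \<le> m\<close>] by simp
  have args: "- m * n - j + m = - m * n + m - j" "- m * n - j - m = - m * n - m - j" "- j - m = - m - j"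
    by simp_all
  have "(\<Sum>i = 0..n - 1. V (- m * i - j)) = (?d *\<^sub>R (\<Sum>i = 0..n - 1. V (- m * i - j))) /\<^sub>R ?d"
    using d by simp
  then show ?thesis
    unfolding scaled_sum_telescopes[OF V \<open>0 \<le> n\<close>] args scaleR_diff_right
    by (simp only: add.commute[of "V (- j + m)"])
qed

theorem theorem2p5:
  fixes m j n :: int
  assumes "m > j" and "j \<ge> 0" and "n \<ge> 1"
  shows "((\<Sum>i = 0..n - 1. trib_matrix (- m * i - j)) =
      (trib_matrix (- m * n + m - j) + trib_matrix (- m * n - m - j)
        + real_of_int (1 - trib_lucas (- m)) *\<^sub>R trib_matrix (- m * n - j))
        /\<^sub>R real_of_int (trib_lucas (- m) - trib_lucas m)
      - (trib_matrix (- m - j) + trib_matrix (- j + m)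
        + real_of_int (1 - trib_lucas (- m)) *\<^sub>R trib_matrix (- j))
        /\<^sub>R real_of_int (trib_lucas (- m) - trib_lucas m))
   \<and> ((\<Sum>i = 0..n - 1. trib_lucas_matrix (- m * i - j)) =
      (trib_lucas_matrix (- m * n + m - j) + trib_lucas_matrix (- m * n - m - j)
        + real_of_int (1 - trib_lucas (- m)) *\<^sub>R trib_lucas_matrix (- m * n - j))
        /\<^sub>R real_of_int (trib_lucas (- m) - trib_lucas m)
      - (trib_lucas_matrix (- m - j) + trib_lucas_matrix (- j + m)
        + real_of_int (1 - trib_lucas (- m)) *\<^sub>R trib_lucas_matrix (- j))
        /\<^sub>R real_of_int (trib_lucas (- m) - trib_lucas m))"
proof -
  have "1 \<le> m" "0 \<le> n" using assms by simp_all
  moreover have "tribonacci_rec trib_matrix" "tribonacci_rec trib_lucas_matrix"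
    unfolding trib_matrix_def trib_lucas_matrix_def by (rule tribonacci_rec_tribonacci_seq)+
  ultimately show ?thesis by (blast intro: tribonacci_progression_sum)
qed

end
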